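(* Assume the special case of the Lander--Parkin--Selfridge conjecture stated in the context. If $k\ge25$ is an integer, $n\ne0$ is an integer, and $(A,B)$ is a bipartite Diophantine tuple with property $BD_k(n)$, then $\max\{|A|,|B|\}\le21736$. In particular, $M_k(n)\le21738$ for all integers $k\ge25$ and $n\ne0$.
   Context: Conjecture (Lander--Parkin--Selfridge, special case): if $k\ge25$ is an integer, then there do not exist distinct positive integers $a_1,b_1,\ldots,a_{12},b_{12}$ such that $\sum_{i=1}^{12}a_i^k=\sum_{i=1}^{12}b_i^k$. $\mathbb{N}$ denotes the set of positive integers, and a (perfect) $k$-th power means an integer $x^k$ with $x\in\mathbb{N}$. For an integer $k\ge2$ and a nonzero integer $n$, a pair $(A,B)$ is a bipartite Diophantine tuple with property $BD_k(n)$ if $A,B\subseteq\mathbb{N}$ each have size at least $2$ and $ab+n$ is a $k$-th power for every $a\in A$, $b\in B$. A set $A\subseteq\mathbb{N}$ has property $D_k(n)$ if $ab+n$ is a $k$-th power for all $a,b\in A$ with $a\ne b$, and $M_k(n)=\sup\{|A|:A\subseteq\mathbb{N}\text{ has property }D_k(n)\}$. *)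

theory Defs
  imports Complex_Main "HOL-Library.Extended_Nat"
begin

text \<open>The paper's natural numbers are the positive integers; subsets of them are rendered as
  sets of type \<^typ>\<open>nat set\<close> not containing \<open>0\<close>.\<close>

text \<open>The base is required to be positive, so \<open>0\<close> is not a \<open>k\<close>-th power.\<close>

definition kth_power :: "nat \<Rightarrow> int \<Rightarrow> bool" where
  "kth_power k m \<longleftrightarrow> (\<exists>x::nat. x > 0 \<and> m = int x ^ k)"

text \<open>Cardinality with value \<open>\<infinity>\<close> on infinite sets (where \<^const>\<open>card\<close> would be \<open>0\<close>).\<close>

definition ecard :: "'a set \<Rightarrow> enat" where
  "ecard A = (if finite A then enat (card A) else \<infinity>)"

text \<open>The two injectivity conditions and the disjointness of the images together say that all
  24 numbers are distinct.\<close>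

definition LPS12_conjecture :: bool where
  "LPS12_conjecture \<longleftrightarrow>
     (\<forall>k::nat. k \<ge> 25 \<longrightarrow>
        \<not> (\<exists>a b :: nat \<Rightarrow> nat.
              (\<forall>i\<in>{1..12}. a i > 0 \<and> b i > 0) \<and>
              inj_on a {1..12} \<and> inj_on b {1..12} \<and> a ` {1..12} \<inter> b ` {1..12} = {} \<and>
              (\<Sum>i=1..12. a i ^ k) = (\<Sum>i=1..12. b i ^ k)))"

definition has_BD :: "nat \<Rightarrow> int \<Rightarrow> nat set \<Rightarrow> nat set \<Rightarrow> bool" where
  "has_BD k n A B \<longleftrightarrow>
     0 \<notin> A \<and> 0 \<notin> B \<and> ecard A \<ge> 2 \<and> ecard B \<ge> 2 \<and>
     (\<forall>a\<in>A. \<forall>b\<in>B. kth_power k (int a * int b + n))"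

definition has_D :: "nat \<Rightarrow> int \<Rightarrow> nat set \<Rightarrow> bool" where
  "has_D k n A \<longleftrightarrow>
     0 \<notin> A \<and> (\<forall>a\<in>A. \<forall>b\<in>A. a \<noteq> b \<longrightarrow> kth_power k (int a * int b + n))"

definition M_max :: "nat \<Rightarrow> int \<Rightarrow> enat" where
  "M_max k n = (SUP A\<in>{A. has_D k n A}. ecard A)"

end

theory Submission
  imports Defs
begin

text \<open>For distinct \<open>a\<^sub>1, a\<^sub>2 \<in> A\<close> and \<open>b \<in> B\<close> write \<open>a\<^sub>1 b + n = x\<^sub>b\<^sup>k\<close> and \<open>a\<^sub>2 b + n = y\<^sub>b\<^sup>k\<close>. The points
  \<open>(x\<^sub>b\<^sup>k, y\<^sub>b\<^sup>k)\<close> lie on a line, so for any three elements of \<open>B\<close> a \<open>3 \<times> 3\<close> determinant vanishes, which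
  is an identity between two sums of three \<open>k\<close>-th powers of products \<open>x\<^sub>b y\<^sub>c\<close>. The line misses the
  origin, so \<open>b \<mapsto> x\<^sub>b / y\<^sub>b\<close> is injective; hence the two sides never share a base, and once
  two of the three elements are fixed, each of the six possible coincidences within a side excludes at
  most one choice of the third. So nine elements of \<open>B\<close> suffice to make all six bases distinct.
  Multiplying such an identity by \<open>k\<close>-th powers and adding the results gives sums with twelve terms.
  This yields the bounds \<open>8\<close> and \<open>10\<close>, well below those claimed.\<close>

text \<open>Using sets instead of indexed families lets \<open>card\<close> express distinctness
  within each side, so identities can be joined by unions and images.\<close>

definition equal_power_sums :: "nat \<Rightarrow> nat \<Rightarrow> nat set \<Rightarrow> nat set \<Rightarrow> bool" where
  "equal_power_sums k m S T \<longleftrightarrow>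
     finite S \<and> card S = m \<and> 0 \<notin> S \<and> finite T \<and> card T = m \<and> 0 \<notin> T \<and>
     S \<inter> T = {} \<and> (\<Sum>s\<in>S. s ^ k) = (\<Sum>t\<in>T. t ^ k)"

lemma LPS12_no_equal_power_sums:
  assumes "LPS12_conjecture" "k \<ge> 25"
  shows "\<not> equal_power_sums k 12 S T"
proof
  assume "equal_power_sums k 12 S T"
  then have S: "finite S" "card S = 12" "0 \<notin> S" and T: "finite T" "card T = 12" "0 \<notin> T"
    and ST: "S \<inter> T = {}" and eq: "(\<Sum>s\<in>S. s ^ k) = (\<Sum>t\<in>T. t ^ k)"
    unfolding equal_power_sums_def by blast+
  obtain f where f: "bij_betw f {1..12::nat} S"
    using finite_same_card_bij[of "{1..12::nat}" S] S by auto
  obtain g where g: "bij_betw g {1..12::nat} T"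
    using finite_same_card_bij[of "{1..12::nat}" T] T by auto
  have "(\<Sum>i=1..12. f i ^ k) = (\<Sum>i=1..12. g i ^ k)"
    using eq sum.reindex_bij_betw[OF f, of "\<lambda>s. s ^ k"] sum.reindex_bij_betw[OF g, of "\<lambda>s. s ^ k"]
    by simp
  moreover have "\<forall>i\<in>{1..12}. f i > 0 \<and> g i > 0"
    using bij_betwE[OF f] bij_betwE[OF g] S(3) T(3) by (metis gr0I)
  moreover have "inj_on f {1..12}" "inj_on g {1..12}" "f ` {1..12} \<inter> g ` {1..12} = {}"
    using f g ST by (auto simp: bij_betw_def)
  ultimately show False
    using assms unfolding LPS12_conjecture_def by blast
qed

text \<open>Scaling an identity by \<open>M\<close> preserves it. If \<open>M\<close> exceeds every
  base of \<open>P\<close> and \<open>Q\<close>, the scaled bases, being positive multiples of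
  \<open>M\<close>, avoid \<open>P \<union> Q\<close>. So each induction step adjoins
  \<open>m\<close> fresh terms per side.\<close>

lemma equal_power_sums_multiply_card:
  assumes "equal_power_sums k m P Q"
  shows "\<exists>S T. equal_power_sums k (r * m) S T"
proof (induction r)
  case 0
  show ?case
    by (intro exI[of _ "{}"]) (simp add: equal_power_sums_def)
next
  case (Suc r)
  then obtain S T where "equal_power_sums k (r * m) S T"
    by blast
  then have S: "finite S" "card S = r * m" "0 \<notin> S" and T: "finite T" "card T = r * m" "0 \<notin> T"
    and ST: "S \<inter> T = {}" "(\<Sum>s\<in>S. s ^ k) = (\<Sum>t\<in>T. t ^ k)"
    unfolding equal_power_sums_def by blast+
  have P: "finite P" "card P = m" "0 \<notin> P" and Q: "finite Q" "card Q = m" "0 \<notin> Q"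
    and PQ: "P \<inter> Q = {}" "(\<Sum>p\<in>P. p ^ k) = (\<Sum>q\<in>Q. q ^ k)"
    using assms unfolding equal_power_sums_def by blast+
  \<comment> \<open>\<open>insert 0\<close> keeps \<open>Max\<close> defined when \<open>P\<close>
    and \<open>Q\<close> are empty, and \<open>Suc\<close> makes the bound strict.\<close>
  define M where "M = Suc (Max (insert 0 (P \<union> Q)))"
  have M: "M > 0"
    by (simp add: M_def)
  have less: "p < M" if "p \<in> P \<union> Q" for p
    using that P(1) Q(1) by (simp add: M_def less_Suc_eq_le)
  have "M \<le> M * s" if "s \<in> S \<union> T" for s
    using that S(3) T(3) by (cases s) auto
  then have "p \<noteq> M * s" if "p \<in> P \<union> Q" "s \<in> S \<union> T" for p s
    using less[OF that(1)] that(2) leD by blast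
  then have sep: "(P \<union> Q) \<inter> (*) M ` (S \<union> T) = {}"
    by blast
  have inj: "inj_on ((*) M) U" for U
    using M by (auto simp: inj_on_def)
  have card: "card (U \<union> (*) M ` V) = card U + card V"
    and sum: "(\<Sum>u\<in>U \<union> (*) M ` V. u ^ k) = (\<Sum>u\<in>U. u ^ k) + M ^ k * (\<Sum>v\<in>V. v ^ k)"
    if "finite U" "finite V" "U \<inter> (*) M ` V = {}" for U V
    using that card_Un_disjoint[of U "(*) M ` V"]
      sum.union_disjoint[of U "(*) M ` V" "\<lambda>u. u ^ k"]
    by (auto simp: card_image[OF inj] sum.reindex[OF inj] power_mult_distrib sum_distrib_left)
  have dP: "P \<inter> (*) M ` S = {}" and dQ: "Q \<inter> (*) M ` T = {}"
    using sep by auto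
  have "(*) M ` S \<inter> (*) M ` T = {}"
    using ST(1) M by auto
  then have "(P \<union> (*) M ` S) \<inter> (Q \<union> (*) M ` T) = {}"
    using sep PQ(1) by auto
  moreover have "0 \<notin> P \<union> (*) M ` S" "0 \<notin> Q \<union> (*) M ` T"
    using P(3) Q(3) S(3) T(3) M by auto
  ultimately have "equal_power_sums k (Suc r * m) (P \<union> (*) M ` S) (Q \<union> (*) M ` T)"
    using card[OF P(1) S(1) dP] card[OF Q(1) T(1) dQ] sum[OF P(1) S(1) dP] sum[OF Q(1) T(1) dQ]
      P(1,2) Q(1,2) S(1,2) T(1,2) ST(2) PQ(2)
    unfolding equal_power_sums_def by simp
  then show ?case
    by blast
qed

lemma card_Collect_le_1:
  assumes "finite C" "\<And>b c. b \<in> C \<Longrightarrow> c \<in> C \<Longrightarrow> R b \<Longrightarrow> R c \<Longrightarrow> b = c"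
  shows "card {c \<in> C. R c} \<le> 1"
  using assms by (simp add: card_le_Suc0_iff_eq)

text \<open>Only two multipliers \<open>a1\<close>, \<open>a2\<close> enter, not a set
  \<open>A\<close>, so that the bound serves both bipartite tuples and, once two elements are
  removed, sets with property \<open>D\<close>.\<close>

lemma LPS12_card_le_8:
  fixes B :: "nat set"
  assumes LPS: "LPS12_conjecture" and k: "k \<ge> 25" and n: "n \<noteq> 0"
    and a: "a1 \<noteq> a2" "a1 > 0" "a2 > 0"
    and kth: "\<And>b. b \<in> B \<Longrightarrow> kth_power k (int a1 * int b + n) \<and> kth_power k (int a2 * int b + n)"
  shows "finite B \<and> card B \<le> 8"
proof (rule ccontr)
  assume "\<not> (finite B \<and> card B \<le> 8)"
  then consider "infinite B" | "9 \<le> card B"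
    by linarith
  then obtain C where C: "C \<subseteq> B" "finite C" "card C = 9"
  proof cases
    case 1
    then show thesis
      using that infinite_arbitrarily_large by metis
  next
    case 2
    then show thesis
      using that obtain_subset_with_card_n by metis
  qed
  have "\<forall>b\<in>C. \<exists>x>0. int a1 * int b + n = int x ^ k" "\<forall>b\<in>C. \<exists>y>0. int a2 * int b + n = int y ^ k"
    using kth C(1) unfolding kth_power_def by blast+
  then obtain x y where x: "\<And>b. b \<in> C \<Longrightarrow> x b > 0 \<and> int (x b) ^ k = int a1 * int b + n"
    and y: "\<And>b. b \<in> C \<Longrightarrow> y b > 0 \<and> int (y b) ^ k = int a2 * int b + n"
    by metis
  have xinj: "b = c" if "b \<in> C" "c \<in> C" "x b = x c" for b c
  proof -
    have "int a1 * int b + n = int a1 * int c + n"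
      using x[OF that(1)] x[OF that(2)] that(3) by metis
    then show ?thesis
      using a by simp
  qed
  have yinj: "b = c" if "b \<in> C" "c \<in> C" "y b = y c" for b c
  proof -
    have "int a2 * int b + n = int a2 * int c + n"
      using y[OF that(1)] y[OF that(2)] that(3) by metis
    then show ?thesis
      using a by simp
  qed
  have ratio: "b = c" if "b \<in> C" "c \<in> C" "x b * y c = x c * y b" for b c
  proof -
    have "int (x b) ^ k * int (y c) ^ k = int (x c) ^ k * int (y b) ^ k"
      using that(3) by (metis of_nat_mult power_mult_distrib)
    then have "(int a1 * int b + n) * (int a2 * int c + n) = (int a1 * int c + n) * (int a2 * int b + n)"
      using x y that(1,2) by simp
    \<comment> \<open>The difference of the two products factors; \<open>n \<noteq> 0\<close> and
      \<open>a1 \<noteq> a2\<close> leave only \<open>b = c\<close>.\<close>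
    then have "n * (int a1 - int a2) * (int b - int c) = 0"
      by (simp add: algebra_simps)
    then show ?thesis
      using n a by simp
  qed
  \<comment> \<open>Both equations say that the ratio of \<open>x\<close> to \<open>y\<close> equals
    \<open>q / p\<close>.\<close>
  have ratio': "b = c" if "b \<in> C" "c \<in> C" "x b * p = q * y b" "x c * p = q * y c" "p > 0" "q > 0"
    for b c p q
  proof (rule ratio[OF that(1,2)])
    have "(x b * y c) * (p * q) = (x b * p) * (q * y c)"
      by (simp add: mult_ac)
    also have "\<dots> = (q * y b) * (x c * p)"
      using that(3,4) by simp
    also have "\<dots> = (x c * y b) * (p * q)"
      by (simp add: mult_ac)
    finally show "x b * y c = x c * y b"
      using that(5,6) by simp
  qed
  obtain u where u: "u \<in> C"
    using C(3) by fastforce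
  have "card (C - {u}) = 8"
    using C u by simp
  then have "C - {u} \<noteq> {}"
    by (metis card.empty zero_neq_numeral)
  then obtain v where v: "v \<in> C" "v \<noteq> u"
    by blast
  have pos: "x u > 0" "y u > 0" "x v > 0" "y v > 0"
    using x y u v by auto
  \<comment> \<open>Of the six coincidences, two determine \<open>y w\<close>, two determine
    \<open>x w\<close>, and the two with \<open>w\<close> on both sides determine the ratio of
    \<open>x w\<close> to \<open>y w\<close>.\<close>
  let ?E = "\<lambda>R. {c \<in> C. R c}"
  have "card (?E (\<lambda>w. x u * y v = x v * y w)) \<le> 1"
    by (rule card_Collect_le_1[OF C(2)], rule yinj) (use pos in simp_all)
  moreover have "card (?E (\<lambda>w. x v * y u = x u * y w)) \<le> 1"
    by (rule card_Collect_le_1[OF C(2)], rule yinj) (use pos in simp_all)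
  moreover have "card (?E (\<lambda>w. x u * y v = x w * y u)) \<le> 1"
    by (rule card_Collect_le_1[OF C(2)], rule xinj) (use pos in simp_all)
  moreover have "card (?E (\<lambda>w. x v * y u = x w * y v)) \<le> 1"
    by (rule card_Collect_le_1[OF C(2)], rule xinj) (use pos in simp_all)
  moreover have "card (?E (\<lambda>w. x w * y u = x v * y w)) \<le> 1"
    by (rule card_Collect_le_1[OF C(2)], rule ratio', assumption+) (use pos in simp_all)
  moreover have "card (?E (\<lambda>w. x w * y v = x u * y w)) \<le> 1"
    by (rule card_Collect_le_1[OF C(2)], rule ratio', assumption+) (use pos in simp_all)
  moreover have "card {u, v} \<le> 2"
    by (simp add: card_insert_if)
  moreover define Z where "Z = {u, v} \<union> ?E (\<lambda>w. x u * y v = x v * y w)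
    \<union> ?E (\<lambda>w. x u * y v = x w * y u) \<union> ?E (\<lambda>w. x w * y u = x v * y w)
    \<union> ?E (\<lambda>w. x v * y u = x w * y v) \<union> ?E (\<lambda>w. x v * y u = x u * y w)
    \<union> ?E (\<lambda>w. x w * y v = x u * y w)"
  \<comment> \<open>The excluded elements number at most 2 + 6 = 8, one fewer than \<open>C\<close>
    has.\<close>
  ultimately have "card Z \<le> 2 + 1 + 1 + 1 + 1 + 1 + 1"
    unfolding Z_def by (intro order.trans[OF card_Un_le add_mono])
  then have "\<not> C \<subseteq> Z"
    using C card_mono[of Z C] by (auto simp: Z_def)
  then obtain w where w: "w \<in> C" "w \<notin> Z"
    by blast
  \<comment> \<open>\<open>P\<close> and \<open>Q\<close> hold the bases of the positive and
    negative terms in the determinant with rows \<open>(1, x b ^ k, y b ^ k)\<close> for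
    \<open>b = u, v, w\<close>.\<close>
  define P where "P = {x u * y v, x v * y w, x w * y u}"
  define Q where "Q = {x v * y u, x w * y v, x u * y w}"
  have wuv: "w \<noteq> u" "w \<noteq> v"
    and dist: "x u * y v \<noteq> x v * y w" "x u * y v \<noteq> x w * y u" "x v * y w \<noteq> x w * y u"
      "x v * y u \<noteq> x w * y v" "x v * y u \<noteq> x u * y w" "x w * y v \<noteq> x u * y w"
    using w by (auto simp: Z_def)
  have posw: "x w > 0" "y w > 0"
    using x y w by auto
  \<comment> \<open>Of the nine pairs from \<open>P\<close> and \<open>Q\<close>, three are swaps of
    indices, excluded by \<open>ratio\<close>; the other six share a factor, which cancels.\<close>
  have "x u * y v \<noteq> x v * y u" "x v * y w \<noteq> x w * y v" "x w * y u \<noteq> x u * y w"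
    using ratio u v w(1) wuv by metis+
  moreover have "x u \<noteq> x v" "x u \<noteq> x w" "x v \<noteq> x w" "y u \<noteq> y v" "y u \<noteq> y w" "y v \<noteq> y w"
    using xinj yinj u v w(1) wuv by metis+
  then have "x u * y v \<noteq> x w * y v" "x u * y v \<noteq> x u * y w" "x v * y w \<noteq> x v * y u"
    "x v * y w \<noteq> x u * y w" "x w * y u \<noteq> x v * y u" "x w * y u \<noteq> x w * y v"
    using pos posw by simp_all
  ultimately have "P \<inter> Q = {}"
    unfolding P_def Q_def by blast
  moreover have "(\<Sum>p\<in>P. p ^ k) = (\<Sum>q\<in>Q. q ^ k)"
  proof -
    define F G where "F b = int a1 * int b + n" and "G b = int a2 * int b + n" for b
    have "int (x b * y c) ^ k = F b * G c" if "b \<in> C" "c \<in> C" for b c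
      using x[OF that(1)] y[OF that(2)] by (simp add: F_def G_def power_mult_distrib)
    then have "int (\<Sum>p\<in>P. p ^ k) = F u * G v + F v * G w + F w * G u"
      "int (\<Sum>q\<in>Q. q ^ k) = F v * G u + F w * G v + F u * G w"
      \<comment> \<open>By \<open>dist\<close> the sums over \<open>P\<close> and \<open>Q\<close>
        have three terms each. Without \<open>of_nat_mult\<close> the products stay whole and match
        the preceding fact.\<close>
      using dist u v(1) w(1) by (simp_all add: P_def Q_def del: of_nat_mult)
    moreover have "F u * G v + F v * G w + F w * G u = F v * G u + F w * G v + F u * G w"
      unfolding F_def G_def by (simp add: algebra_simps)
    ultimately show ?thesis
      by linarith
  qed
  moreover have "finite P" "card P = 3" "0 \<notin> P" "finite Q" "card Q = 3" "0 \<notin> Q"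
    using dist pos posw by (auto simp: P_def Q_def)
  ultimately have "equal_power_sums k 3 P Q"
    unfolding equal_power_sums_def by blast
  \<comment> \<open>Four copies of the three-term identity give twelve terms per side.\<close>
  then show False
    using equal_power_sums_multiply_card[of k 3 P Q 4] LPS12_no_equal_power_sums[OF LPS k] by simp
qed

lemma two_le_ecardD:
  assumes "ecard A \<ge> 2"
  obtains a1 a2 where "a1 \<in> A" "a2 \<in> A" "a1 \<noteq> a2"
proof (rule ccontr)
  assume "\<not> thesis"
  then have "\<forall>a\<in>A. \<forall>b\<in>A. a = b"
    using that by blast
  then have "A = {} \<or> (\<exists>a. A = {a})"
    by blast
  then show False
    using assms by (auto simp: ecard_def numeral_eq_enat)
qed

lemma has_BD_commute: "has_BD k n A B \<Longrightarrow> has_BD k n B A"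
  unfolding has_BD_def by (metis mult.commute)

lemma has_BD_ecard_le:
  assumes "LPS12_conjecture" "k \<ge> 25" "n \<noteq> 0" "has_BD k n A B"
  shows "ecard B \<le> 8"
proof -
  obtain a1 a2 where "a1 \<in> A" "a2 \<in> A" "a1 \<noteq> a2"
    using assms(4) two_le_ecardD unfolding has_BD_def by metis
  then have "finite B \<and> card B \<le> 8"
    using assms(4) by (intro LPS12_card_le_8[OF assms(1-3)]) (auto simp: has_BD_def intro: gr0I)
  then show ?thesis
    by (simp add: ecard_def numeral_eq_enat)
qed

text \<open>Property \<open>D\<close> says nothing about \<open>a * a\<close>, so \<open>a1\<close>
  and \<open>a2\<close> are removed before the bound 8 is applied to the rest; putting them back
  gives 10.\<close>

lemma has_D_ecard_le:
  assumes "LPS12_conjecture" "k \<ge> 25" "n \<noteq> 0" "has_D k n A"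
  shows "ecard A \<le> 10"
proof (cases "ecard A \<ge> 2")
  case True
  then obtain a1 a2 where a: "a1 \<in> A" "a2 \<in> A" "a1 \<noteq> a2"
    by (rule two_le_ecardD)
  have "finite (A - {a1, a2}) \<and> card (A - {a1, a2}) \<le> 8"
    using assms(4) a by (intro LPS12_card_le_8[OF assms(1-3)]) (auto simp: has_D_def intro: gr0I)
  moreover from this have "card A = card (A - {a1, a2}) + 2"
    using a card_Diff_subset[of "{a1, a2}" A] card_mono[of A "{a1, a2}"] by simp
  ultimately show ?thesis
    by (simp add: ecard_def numeral_eq_enat)
next
  case False
  then have "ecard A \<le> 2"
    by simp
  also have "(2::enat) \<le> 10"
    by simp
  finally show ?thesis .
qed

theorem theorem2p10:
  assumes LPS: "LPS12_conjecture"
  shows "(\<forall>(k::nat) (n::int) (A::nat set) (B::nat set).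
            k \<ge> 25 \<longrightarrow> n \<noteq> 0 \<longrightarrow> has_BD k n A B \<longrightarrow> max (ecard A) (ecard B) \<le> 21736)
       \<and> (\<forall>(k::nat) (n::int). k \<ge> 25 \<longrightarrow> n \<noteq> 0 \<longrightarrow> M_max k n \<le> 21738)"
proof (intro conjI allI impI)
  fix k :: nat and n :: int and A B :: "nat set"
  assume "k \<ge> 25" "n \<noteq> 0" "has_BD k n A B"
  then have "max (ecard A) (ecard B) \<le> 8"
    using has_BD_ecard_le[OF LPS] has_BD_commute by (metis max.bounded_iff)
  also have "(8::enat) \<le> 21736"
    by simp
  finally show "max (ecard A) (ecard B) \<le> 21736" .
next
  fix k :: nat and n :: int
  assume "k \<ge> 25" "n \<noteq> 0"
  then have "M_max k n \<le> 10"
    unfolding M_max_def using has_D_ecard_le[OF LPS] by (intro SUP_least) simp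
  also have "(10::enat) \<le> 21738"
    by simp
  finally show "M_max k n \<le> 21738" .
qed

end
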